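(* Let $\beta \in (0,1)$ be fixed, set $\varepsilon_n = n^{-\beta}$, and let $(\sigma_n)$ be a sequence of positive numbers. Consider, as $n \to \infty$, the problem of testing, based on $X_1,\dots,X_n$, the null hypothesis $\mathcal{H}_0$ that $X_1,\dots,X_n$ are iid $\mathcal{N}(0,1)$ versus the alternative $\mathcal{H}_1$ that $X_1,\dots,X_n$ are iid from the mixture $(1-\varepsilon_n)\,\mathcal{N}(0,1) + \varepsilon_n\,\mathcal{N}(0,\sigma_n^2)$. (i) The chi-squared test is asymptotically powerful when $\beta < 1/2$ and either $\sigma_n$ is bounded away from $1$, or $|\sigma_n - 1| = n^{-\gamma}$ for a fixed $\gamma > 0$ with $\gamma < 1/2 - \beta$. (ii) The chi-squared test is asymptotically powerless when $\beta > 1/2$ and $(\sigma_n)$ is bounded.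
   Context: $\mathcal{N}(0,s^2)$ denotes the centered Gaussian distribution on $\mathbb{R}$ with variance $s^2$. The asymptotic regime is $n \to \infty$, and only $n$ large enough that $\varepsilon_n < 1/2$ is considered. The chi-squared test rejects $\mathcal{H}_0$ for large values of $\big|\sum_{i=1}^n X_i^2 - n\big|$, i.e., it has rejection region $\{|\sum_{i=1}^n X_i^2 - n| \ge c_n\}$ for some critical value $c_n$. The risk of a test is the sum of its probabilities of Type I error (rejecting under $\mathcal{H}_0$) and Type II error (not rejecting under $\mathcal{H}_1$). A sequence of tests is asymptotically powerless if the limit inferior of its risk as $n\to\infty$ is at least $1$, and asymptotically powerful if its risk tends to $0$. The chi-squared test is said to be asymptotically powerful if this holds for some choice of critical values $(c_n)$, and asymptotically powerless if this holds for every choice of critical values $(c_n)$. *)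

theory Defs
  imports "HOL-Probability.Probability"
begin

text \<open>The parameter of \<open>gaussian\<close> is the standard deviation, not the variance.\<close>

definition gaussian :: "real \<Rightarrow> real measure" where
  "gaussian s = density lborel (normal_density 0 s)"

text \<open>The mixture of the laws of mean 0 and standard deviations 1 and \<open>s\<close>, given by its
  Lebesgue density; \<open>measure_mixture\<close> below recovers the convex combination of measures.\<close>

definition mixture :: "real \<Rightarrow> real \<Rightarrow> real measure" where
  "mixture e s =
     density lborel (\<lambda>x. (1 - e) * normal_density 0 1 x + e * normal_density 0 s x)"

definition iid_sample :: "nat \<Rightarrow> real measure \<Rightarrow> (nat \<Rightarrow> real) measure" where
  "iid_sample n M = Pi\<^sub>M {..<n} (\<lambda>_. M)"

text \<open>A test is identified with its rejection region \<open>R\<close>.\<close>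

definition risk :: "'a measure \<Rightarrow> 'a measure \<Rightarrow> 'a set \<Rightarrow> real" where
  "risk P0 P1 R = measure P0 R + measure P1 (space P1 - R)"

definition asymptotically_powerful :: "(nat \<Rightarrow> real) \<Rightarrow> bool" where
  "asymptotically_powerful r \<longleftrightarrow> r \<longlonglongrightarrow> 0"

definition asymptotically_powerless :: "(nat \<Rightarrow> real) \<Rightarrow> bool" where
  "asymptotically_powerless r \<longleftrightarrow> liminf (\<lambda>n. ereal (r n)) \<ge> 1"

definition eps :: "real \<Rightarrow> nat \<Rightarrow> real" where
  "eps \<beta> n = real n powr (- \<beta>)"

text \<open>The sample sizes under consideration. Conditions on \<open>\<sigma>\<close> are imposed only for these:
  for instance \<open>\<sigma> n = 1 - real n powr (- \<gamma>)\<close> vanishes at \<open>n = 1\<close>. The condition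
  \<open>n \<ge> 1\<close> is needed because \<open>0 powr a = 0\<close>.\<close>

definition admissible :: "real \<Rightarrow> nat \<Rightarrow> bool" where
  "admissible \<beta> n \<longleftrightarrow> n \<ge> 1 \<and> eps \<beta> n < 1 / 2"

definition chi_squared_region :: "nat \<Rightarrow> real \<Rightarrow> (nat \<Rightarrow> real) set" where
  "chi_squared_region n c =
     {x \<in> space (Pi\<^sub>M {..<n} (\<lambda>_. borel)). \<bar>(\<Sum>i<n. (x i)\<^sup>2) - real n\<bar> \<ge> c}"

definition chi_squared_risk ::
    "real \<Rightarrow> (nat \<Rightarrow> real) \<Rightarrow> (nat \<Rightarrow> real) \<Rightarrow> nat \<Rightarrow> real" where
  "chi_squared_risk \<beta> \<sigma> c n =
     risk (iid_sample n (gaussian 1)) (iid_sample n (mixture (eps \<beta> n) (\<sigma> n)))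
       (chi_squared_region n (c n))"

definition chi_squared_powerful :: "real \<Rightarrow> (nat \<Rightarrow> real) \<Rightarrow> bool" where
  "chi_squared_powerful \<beta> \<sigma> \<longleftrightarrow>
     (\<exists>c. asymptotically_powerful (chi_squared_risk \<beta> \<sigma> c))"

definition chi_squared_powerless :: "real \<Rightarrow> (nat \<Rightarrow> real) \<Rightarrow> bool" where
  "chi_squared_powerless \<beta> \<sigma> \<longleftrightarrow>
     (\<forall>c. asymptotically_powerless (chi_squared_risk \<beta> \<sigma> c))"

lemma prob_space_gaussian: "s > 0 \<Longrightarrow> prob_space (gaussian s)"
  unfolding gaussian_def by (rule prob_space_normal_density)

lemma emeasure_mixture:
  assumes "0 \<le> e" "e \<le> 1" "A \<in> sets borel"
  shows "emeasure (mixture e s) A =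
    ennreal (1 - e) * emeasure (gaussian 1) A + ennreal e * emeasure (gaussian s) A"
proof -
  have "emeasure (mixture e s) A = (\<integral>\<^sup>+x. (ennreal (1 - e) * (ennreal (normal_density 0 1 x) * indicator A x)
      + ennreal e * (ennreal (normal_density 0 s x) * indicator A x)) \<partial>lborel)"
    unfolding mixture_def using assms
    by (subst emeasure_density)
       (auto intro!: nn_integral_cong simp: ennreal_mult ennreal_plus distrib_right mult.assoc
             simp del: ennreal_plus[symmetric] split: split_indicator)
  also have "\<dots> = ennreal (1 - e) * emeasure (gaussian 1) A + ennreal e * emeasure (gaussian s) A"
    unfolding gaussian_def using assms
    by (simp add: emeasure_density nn_integral_add nn_integral_cmult)
  finally show ?thesis .
qed

lemma prob_space_mixture:
  assumes "0 \<le> e" "e \<le> 1" "s > 0"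
  shows "prob_space (mixture e s)"
proof
  have *: "emeasure (gaussian t) UNIV = 1" if "t > 0" for t
    using prob_space.emeasure_space_1[OF prob_space_gaussian[OF that]] by (simp add: gaussian_def)
  have "emeasure (mixture e s) UNIV = ennreal (1 - e) + ennreal e"
    using assms by (simp add: emeasure_mixture *)
  also have "\<dots> = 1" using assms by (simp flip: ennreal_plus)
  finally show "emeasure (mixture e s) (space (mixture e s)) = 1" by (simp add: mixture_def)
qed

lemma measure_mixture:
  assumes "0 \<le> e" "e \<le> 1" "s > 0" "A \<in> sets borel"
  shows "measure (mixture e s) A = (1 - e) * measure (gaussian 1) A + e * measure (gaussian s) A"
proof -
  interpret g1: prob_space "gaussian 1" by (rule prob_space_gaussian) simp
  interpret gs: prob_space "gaussian s" by (rule prob_space_gaussian) fact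
  interpret m: prob_space "mixture e s" by (rule prob_space_mixture) fact+
  show ?thesis
    using emeasure_mixture[OF assms(1,2,4), of s] assms
    by (simp add: g1.emeasure_eq_measure gs.emeasure_eq_measure m.emeasure_eq_measure
        flip: ennreal_mult ennreal_plus)
qed

lemma chi_squared_region_sets:
  assumes "sets M = sets borel"
  shows "chi_squared_region n c \<in> sets (iid_sample n M)"
proof -
  have "sets (iid_sample n M) = sets (Pi\<^sub>M {..<n} (\<lambda>_. borel))"
    unfolding iid_sample_def using assms by (intro sets_PiM_cong) auto
  moreover have "chi_squared_region n c \<in> sets (Pi\<^sub>M {..<n} (\<lambda>_. borel))"
    unfolding chi_squared_region_def by measurable
  ultimately show ?thesis by simp
qed

end

theory Submission
  imports Defs "HOL-Real_Asymp.Real_Asymp"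
begin

text \<open>
  Write \<open>T\<close> for the sum of the \<open>X\<^sub>i\<^sup>2\<close>. Contamination shifts the mean of \<open>T\<close> by
  \<open>m = n \<epsilon>\<^sub>n (\<sigma>\<^sub>n\<^sup>2 - 1)\<close>, while under the null hypothesis \<open>T\<close> fluctuates around \<open>n\<close> on the
  scale \<open>sqrt n\<close>. The test works when the shift dominates the fluctuations under both hypotheses,
  and fails when the shift is negligible.

  For the positive part, take the critical value \<open>\<bar>m\<bar> / 2\<close> and apply Chebyshev's inequality under
  both hypotheses. Under the alternative the variance of \<open>X\<^sup>2\<close> is at most
  \<open>6 + 5 \<epsilon>\<^sub>n (\<sigma>\<^sub>n\<^sup>2 - 1)\<^sup>2\<close>, so the risk is of order
  \<open>1 / (n \<epsilon>\<^sub>n\<^sup>2 (\<sigma>\<^sub>n\<^sup>2 - 1)\<^sup>2) + 1 / (n \<epsilon>\<^sub>n)\<close> (lemma \<open>chi_squared_risk_le\<close>). A large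
  \<open>\<sigma>\<^sub>n\<close> does no harm because it increases the squared shift as fast as the variance.

  For the negative part, \<open>sqrt n * \<epsilon>\<^sub>n\<close> tends to 0, and a comparison of characteristic
  functions shows that \<open>(T - n) / sqrt (2 n)\<close> is asymptotically standard normal under the
  alternative just as under the null hypothesis (\<open>chi_squared_statistic_weak_conv\<close>). Because the
  normal law has no atoms, the distribution functions converge uniformly
  (\<open>weak_conv_m_imp_uniform_limit_cdf\<close>), so for any critical values the
  rejection probabilities under the two hypotheses differ by a null sequence, and the risk tends
  to 1.
\<close>

section \<open>Gaussian laws and their mixtures\<close>

lemma space_gaussian [simp]: "space (gaussian s) = UNIV"
  and sets_gaussian [simp, measurable_cong]: "sets (gaussian s) = sets borel"
  and space_mixture [simp]: "space (mixture e s) = UNIV"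
  and sets_mixture [simp, measurable_cong]: "sets (mixture e s) = sets borel"
  by (simp_all add: gaussian_def mixture_def)

text \<open>The null law is the mixture with weight 0, so every statement about mixtures below also
  covers the null hypothesis.\<close>

lemma mixture_0: "mixture 0 s = gaussian 1"
  by (simp add: mixture_def gaussian_def)

lemma gaussian_integrable_power [simp]: "s > 0 \<Longrightarrow> integrable (gaussian s) (\<lambda>x. x ^ k)"
  using integrable_normal_moment[of s 0 k]
  by (simp add: gaussian_def integrable_density)

lemma gaussian_even_moment:
  assumes "s > 0"
  shows "(\<integral>x. x ^ (2 * k) \<partial>gaussian s) = fact (2 * k) / ((2 / s\<^sup>2) ^ k * fact k)"
  using integral_normal_moment_even[OF assms, of 0 k]
  by (simp add: gaussian_def integral_density)

lemma gaussian_moment_2: "s > 0 \<Longrightarrow> (\<integral>x. x\<^sup>2 \<partial>gaussian s) = s\<^sup>2"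
  using gaussian_even_moment[of s 1] by simp

lemma gaussian_moment_4: "s > 0 \<Longrightarrow> (\<integral>x. x ^ 4 \<partial>gaussian s) = 3 * s ^ 4"
  using gaussian_even_moment[of s 2]
  by (simp add: fact_numeral power2_eq_square power4_eq_xxxx field_simps)

text \<open>The values of \<open>f\<close> may be complex: besides the moments, this is applied to the characteristic
  function of \<open>X\<^sup>2 - 1\<close>.\<close>

lemma
  fixes f :: "real \<Rightarrow> 'b :: {banach, second_countable_topology}"
  assumes e: "0 \<le> e" "e \<le> 1" and "s > 0"
    and f: "integrable (gaussian 1) f" "integrable (gaussian s) f"
  shows integrable_mixture: "integrable (mixture e s) f"
    and integral_mixture:
      "(\<integral>x. f x \<partial>mixture e s) = (1 - e) *\<^sub>R (\<integral>x. f x \<partial>gaussian 1) + e *\<^sub>R (\<integral>x. f x \<partial>gaussian s)"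
proof -
  have [measurable]: "f \<in> borel_measurable borel"
    using borel_measurable_integrable[OF f(1)] by (simp add: measurable_cong_sets[OF sets_gaussian refl])
  have int: "integrable lborel (\<lambda>x. normal_density 0 1 x *\<^sub>R f x)"
    "integrable lborel (\<lambda>x. normal_density 0 s x *\<^sub>R f x)"
    using f by (simp_all add: gaussian_def integrable_density)
  have split: "((1 - e) * normal_density 0 1 x + e * normal_density 0 s x) *\<^sub>R f x =
      (1 - e) *\<^sub>R normal_density 0 1 x *\<^sub>R f x + e *\<^sub>R normal_density 0 s x *\<^sub>R f x" for x
    by (simp add: scaleR_add_left)
  have nonneg: "AE x in lborel. 0 \<le> (1 - e) * normal_density 0 1 x + e * normal_density 0 s x"
    using e by simp
  show "integrable (mixture e s) f"
    unfolding mixture_def using int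
    by (subst integrable_density[OF _ _ nonneg])
       (auto simp: split simp del: scaleR_scaleR)
  show "(\<integral>x. f x \<partial>mixture e s) = (1 - e) *\<^sub>R (\<integral>x. f x \<partial>gaussian 1) + e *\<^sub>R (\<integral>x. f x \<partial>gaussian s)"
    unfolding mixture_def gaussian_def using int
    by (subst integral_density[OF _ _ nonneg])
       (simp_all add: split integral_density del: scaleR_scaleR)
qed

context
  fixes e s :: real
  assumes es: "0 \<le> e" "e \<le> 1" "s > 0"
begin

interpretation prob_space "mixture e s"
  using es by (rule prob_space_mixture)

lemma mixture_integrable_power [simp]: "integrable (mixture e s) (\<lambda>x. x ^ k)"
  using es by (intro integrable_mixture) auto

lemma mixture_moment_2: "(\<integral>x. x\<^sup>2 \<partial>mixture e s) = 1 + e * (s\<^sup>2 - 1)"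
  using es by (subst integral_mixture) (auto simp: gaussian_moment_2 algebra_simps)

lemma mixture_moment_4: "(\<integral>x. x ^ 4 \<partial>mixture e s) = 3 + 3 * e * (s ^ 4 - 1)"
  using es by (subst integral_mixture) (auto simp: gaussian_moment_4 algebra_simps)

lemma mixture_integrable_square_square: "integrable (mixture e s) (\<lambda>x. (x\<^sup>2)\<^sup>2)"
  using mixture_integrable_power[of 4] by (simp flip: power_mult)

lemma mixture_variance_square:
  "variance (\<lambda>x. x\<^sup>2) = 3 + 3 * e * (s ^ 4 - 1) - (1 + e * (s\<^sup>2 - 1))\<^sup>2"
  using variance_eq[of "\<lambda>x. x\<^sup>2"] mixture_integrable_square_square
  by (simp add: mixture_moment_2 mixture_moment_4 flip: power_mult)

text \<open>The bound has the shape required by Chebyshev's inequality uniformly in \<open>s\<close>: for a mean shift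
  \<open>e * (s\<^sup>2 - 1)\<close> per observation, the part of the variance that grows with \<open>s\<close> is only
  \<open>5 / e\<close> times the squared shift. The mixed term \<open>4 e u\<close>, where
  \<open>u = s\<^sup>2 - 1\<close>, is absorbed by \<open>2 u \<le> 2 + u\<^sup>2\<close>.\<close>

lemma mixture_variance_square_le:
  "variance (\<lambda>x. x\<^sup>2) \<le> 6 + 5 * e * (s\<^sup>2 - 1)\<^sup>2"
proof -
  define u where "u = s\<^sup>2 - 1"
  have s2: "s\<^sup>2 = 1 + u" and s4: "s ^ 4 = (1 + u)\<^sup>2"
    by (simp_all add: u_def power2_eq_square power4_eq_xxxx)
  have "variance (\<lambda>x. x\<^sup>2) = 2 + 4 * (e * u) + 3 * (e * u\<^sup>2) - (e * u)\<^sup>2"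
    unfolding mixture_variance_square s2 s4 by (simp add: power2_eq_square algebra_simps)
  also have "\<dots> \<le> 2 + 4 * (e * u) + 3 * (e * u\<^sup>2)" by simp
  also have "4 * (e * u) \<le> 4 * e + 2 * (e * u\<^sup>2)"
  proof -
    have "2 * u \<le> 2 + u\<^sup>2"
      using sum_power2_ge_zero[of "u - 1" 0] by (simp add: power2_eq_square algebra_simps)
    then have "(2 * e) * (2 * u) \<le> (2 * e) * (2 + u\<^sup>2)" using es by (intro mult_left_mono) auto
    then show ?thesis by (simp add: algebra_simps)
  qed
  finally show ?thesis using es by (simp add: u_def)
qed

end

section \<open>Sums over an iid sample\<close>

lemma (in prob_space) distr_PiM_coordinate:
  fixes I :: "'i set"
  assumes i: "i \<in> I"
  shows "distr (Pi\<^sub>M I (\<lambda>_. M)) M (\<lambda>\<omega>. \<omega> i) = M"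
  using i by (intro distr_PiM_component) (auto intro: prob_space_axioms)

lemma (in prob_space) indep_vars_PiM_coordinates:
  "prob_space.indep_vars (Pi\<^sub>M I (\<lambda>_. M)) (\<lambda>_. M) (\<lambda>i \<omega>. \<omega> i) I"
proof (cases "I = {}")
  interpret P: prob_space "Pi\<^sub>M I (\<lambda>_. M)" by (rule prob_space_PiM) (rule prob_space_axioms)
  case True
  then show ?thesis unfolding P.indep_vars_def P.indep_sets_def by simp
next
  interpret P: prob_space "Pi\<^sub>M I (\<lambda>_. M)" by (rule prob_space_PiM) (rule prob_space_axioms)
  case False
  have "distr (Pi\<^sub>M I (\<lambda>_. M)) (Pi\<^sub>M I (\<lambda>_. M)) (\<lambda>\<omega>. \<lambda>i\<in>I. \<omega> i) =
      distr (Pi\<^sub>M I (\<lambda>_. M)) (Pi\<^sub>M I (\<lambda>_. M)) (\<lambda>\<omega>. \<omega>)"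
    by (intro distr_cong) (auto simp: space_PiM)
  also have "\<dots> = Pi\<^sub>M I (\<lambda>i. distr (Pi\<^sub>M I (\<lambda>_. M)) M (\<lambda>\<omega>. \<omega> i))"
    by (simp add: distr_PiM_coordinate cong: PiM_cong)
  finally show ?thesis
    using False by (subst P.indep_vars_iff_distr_eq_PiM') auto
qed

text \<open>Square integrability of the sum is proved along with the formula because the induction step
  needs it to expand the variance.\<close>

lemma (in prob_space) variance_sum_indep:
  fixes X :: "'i \<Rightarrow> 'a \<Rightarrow> real"
  assumes "finite I" "indep_vars (\<lambda>_. borel) X I"
    and "\<And>i. i \<in> I \<Longrightarrow> integrable M (\<lambda>\<omega>. (X i \<omega>)\<^sup>2)"
  shows "integrable M (\<lambda>\<omega>. (\<Sum>i\<in>I. X i \<omega>)\<^sup>2) \<and>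
    variance (\<lambda>\<omega>. \<Sum>i\<in>I. X i \<omega>) = (\<Sum>i\<in>I. variance (X i))"
  using assms
proof (induction I rule: finite_induct)
  case empty
  then show ?case by simp
next
  case (insert j I)
  have rv: "random_variable borel (X i)" if "i \<in> insert j I" for i
    using insert.prems(1) that by (auto simp: indep_vars_def2)
  have int: "integrable M (X i)" if "i \<in> insert j I" for i
    by (rule square_integrable_imp_integrable[OF rv[OF that] insert.prems(2)[OF that]])
  define S where "S = (\<lambda>\<omega>. \<Sum>i\<in>I. X i \<omega>)"
  have IH: "integrable M (\<lambda>\<omega>. (S \<omega>)\<^sup>2)" "variance S = (\<Sum>i\<in>I. variance (X i))"
    using insert.IH indep_vars_subset[OF insert.prems(1), of I] insert.prems(2)
    by (auto simp: S_def)
  have intS: "integrable M S" unfolding S_def using int by auto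
  have ind: "indep_var borel (X j) borel S"
    unfolding S_def using insert by (intro indep_vars_sum) auto
  have intp: "integrable M (\<lambda>\<omega>. X j \<omega> * S \<omega>)"
    and expp: "expectation (\<lambda>\<omega>. X j \<omega> * S \<omega>) = expectation (X j) * expectation S"
    using ind int intS by (auto intro!: indep_var_integrable indep_var_lebesgue_integral)
  have sq: "(X j \<omega> + S \<omega>)\<^sup>2 = (X j \<omega>)\<^sup>2 + (S \<omega>)\<^sup>2 + 2 * (X j \<omega> * S \<omega>)" for \<omega>
    by (simp add: power2_sum)
  have int2: "integrable M (\<lambda>\<omega>. (X j \<omega> + S \<omega>)\<^sup>2)"
    unfolding sq using insert.prems(2) IH(1) intp by auto
  have "variance (\<lambda>\<omega>. X j \<omega> + S \<omega>) = variance (X j) + variance S"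
  proof -
    have "expectation (\<lambda>\<omega>. (X j \<omega> + S \<omega>)\<^sup>2) = expectation (\<lambda>\<omega>. (X j \<omega>)\<^sup>2) + expectation (\<lambda>\<omega>. (S \<omega>)\<^sup>2)
        + 2 * (expectation (X j) * expectation S)"
      unfolding sq using insert.prems(2) IH(1) intp by (simp add: expp del: mult.assoc)
    moreover have "expectation (\<lambda>\<omega>. X j \<omega> + S \<omega>) = expectation (X j) + expectation S"
      using int intS by simp
    ultimately show ?thesis
      using int intS int2 insert.prems(2) IH(1) by (subst (1 2 3) variance_eq) (auto simp: power2_sum)
  qed
  with int2 IH(2) insert.hyps show ?case by (simp add: S_def)
qed

lemma iid_sample_Chebyshev:
  fixes f :: "'a \<Rightarrow> real" and n :: nat
  assumes "prob_space M" and [measurable]: "f \<in> borel_measurable M"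
    and int: "integrable M (\<lambda>x. (f x)\<^sup>2)" and "a > 0"
  defines "P \<equiv> Pi\<^sub>M {..<n} (\<lambda>_. M)"
  shows "measure P {x \<in> space P. \<bar>(\<Sum>i<n. f (x i)) - real n * (\<integral>x. f x \<partial>M)\<bar> \<ge> a}
    \<le> real n * prob_space.variance M f / a\<^sup>2"
proof -
  interpret M: prob_space M by fact
  interpret P: prob_space P unfolding P_def by (rule prob_space_PiM) (rule M.prob_space_axioms)
  have rv [measurable]: "(\<lambda>x. f (x i)) \<in> borel_measurable P" if "i < n" for i
    unfolding P_def using that
    by (intro measurable_compose[OF measurable_component_singleton]) auto
  have tr: "(\<integral>x. g (x i) \<partial>P) = (\<integral>x. g x \<partial>M)" and tr': "integrable P (\<lambda>x. g (x i)) \<longleftrightarrow> integrable M g"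
    if "i < n" "g \<in> borel_measurable M" for i and g :: "'a \<Rightarrow> real"
  proof -
    have c: "(\<lambda>x. x i) \<in> measurable P M" and d: "distr P M (\<lambda>x. x i) = M"
      using that M.distr_PiM_coordinate[of i "{..<n}"] by (simp_all add: P_def)
    show "(\<integral>x. g (x i) \<partial>P) = (\<integral>x. g x \<partial>M)" "integrable P (\<lambda>x. g (x i)) \<longleftrightarrow> integrable M g"
      using integral_distr[OF c that(2)] integrable_distr_eq[OF c that(2)] by (simp_all add: d)
  qed
  have "P.indep_vars (\<lambda>_. borel) (\<lambda>i x. f (x i)) {..<n}"
    unfolding P_def by (rule prob_space.indep_vars_compose2[OF prob_space_PiM M.indep_vars_PiM_coordinates])
      (simp_all add: assms)
  moreover have "integrable P (\<lambda>x. (f (x i))\<^sup>2)" if "i \<in> {..<n}" for i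
    using int tr'[of i "\<lambda>x. (f x)\<^sup>2"] that by simp
  ultimately have V: "integrable P (\<lambda>x. (\<Sum>i<n. f (x i))\<^sup>2)"
    "P.variance (\<lambda>x. \<Sum>i<n. f (x i)) = (\<Sum>i<n. P.variance (\<lambda>x. f (x i)))"
    using P.variance_sum_indep[of "{..<n}" "\<lambda>i x. f (x i)"] by auto
  have "P.variance (\<lambda>x. f (x i)) = M.variance f" if "i < n" for i
    using tr[OF that, of f] tr[OF that, of "\<lambda>x. (f x - M.expectation f)\<^sup>2"] by simp
  then have var: "P.variance (\<lambda>x. \<Sum>i<n. f (x i)) = real n * M.variance f"
    using V(2) by simp
  have "integrable M f" by (rule M.square_integrable_imp_integrable) (use int in auto)
  then have "P.expectation (\<lambda>x. \<Sum>i<n. f (x i)) = real n * M.expectation f"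
    by (subst Bochner_Integration.integral_sum) (simp_all add: tr tr')
  with P.Chebyshev_inequality[OF _ V(1) \<open>a > 0\<close>] var show ?thesis by simp
qed

section \<open>Power: Chebyshev's inequality\<close>

text \<open>The mean of \<open>\<Sum>X\<^sub>i\<^sup>2 - n\<close> moves from 0 to
  \<open>m = n e (s\<^sup>2 - 1)\<close>. With the critical value \<open>\<bar>m\<bar> / 2\<close>, either kind of error forces the
  statistic at least \<open>\<bar>m\<bar> / 2\<close> away from its mean, so Chebyshev's inequality bounds both errors.
  The first term of the bound comes from the constant part of the variance of
  \<open>X\<^sup>2\<close>, the second one from the part proportional to \<open>e (s\<^sup>2 - 1)\<^sup>2\<close>.\<close>

lemma chi_squared_risk_le:
  assumes es: "0 < e" "e \<le> 1" "s > 0" "s \<noteq> 1" and n: "n > 0"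
  shows "risk (iid_sample n (gaussian 1)) (iid_sample n (mixture e s))
      (chi_squared_region n (real n * e * \<bar>s\<^sup>2 - 1\<bar> / 2))
    \<le> 48 / (real n * (e * (s\<^sup>2 - 1))\<^sup>2) + 20 / (real n * e)"
proof -
  define m where "m = real n * e * (s\<^sup>2 - 1)"
  define a where "a = real n * e * \<bar>s\<^sup>2 - 1\<bar> / 2"
  define P0 where "P0 = iid_sample n (mixture 0 1)"
  define P1 where "P1 = iid_sample n (mixture e s)"
  define T where "T x = (\<Sum>i<n. (x i)\<^sup>2)" for x :: "nat \<Rightarrow> real"
  have am: "a = \<bar>m\<bar> / 2" using es by (simp add: a_def m_def abs_mult)
  have "s\<^sup>2 - 1 \<noteq> 0" using es by (simp add: power2_eq_1_iff)
  then have a: "a > 0" using es n by (simp add: a_def)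
  have sp: "space P0 = space (Pi\<^sub>M {..<n} (\<lambda>_. borel))" "space P1 = space (Pi\<^sub>M {..<n} (\<lambda>_. borel))"
    by (simp_all add: P0_def P1_def iid_sample_def space_PiM)
  interpret P1: prob_space P1
    unfolding P1_def iid_sample_def using es by (intro prob_space_PiM prob_space_mixture) auto
  have [measurable]: "T \<in> borel_measurable P1"
    unfolding T_def P1_def iid_sample_def by measurable
  have Cheb: "measure (iid_sample n (mixture e' s'))
      {x \<in> space (iid_sample n (mixture e' s')). \<bar>T x - real n * (1 + e' * (s'\<^sup>2 - 1))\<bar> \<ge> a}
      \<le> real n * (6 + 5 * e' * (s'\<^sup>2 - 1)\<^sup>2) / a\<^sup>2" if "0 \<le> e'" "e' \<le> 1" "s' > 0" for e' s'
  proof -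
    have "measure (iid_sample n (mixture e' s'))
      {x \<in> space (iid_sample n (mixture e' s')). \<bar>T x - real n * (1 + e' * (s'\<^sup>2 - 1))\<bar> \<ge> a}
      \<le> real n * prob_space.variance (mixture e' s') (\<lambda>x. x\<^sup>2) / a\<^sup>2"
      using iid_sample_Chebyshev[OF prob_space_mixture[OF that] _ mixture_integrable_square_square[OF that] a, of n]
      by (simp add: iid_sample_def T_def mixture_moment_2[OF that])
    also have "\<dots> \<le> real n * (6 + 5 * e' * (s'\<^sup>2 - 1)\<^sup>2) / a\<^sup>2"
      using mixture_variance_square_le[OF that] by (intro divide_right_mono mult_left_mono) auto
    finally show ?thesis .
  qed
  have "measure P0 (chi_squared_region n a) \<le> real n * 6 / a\<^sup>2"
    using Cheb[of 0 1] by (simp add: chi_squared_region_def sp flip: P0_def) (simp add: T_def)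
  moreover have "measure P1 (space P1 - chi_squared_region n a) \<le> real n * (6 + 5 * e * (s\<^sup>2 - 1)\<^sup>2) / a\<^sup>2"
  proof -
    have "measure P1 (space P1 - chi_squared_region n a) \<le>
        measure P1 {x \<in> space P1. \<bar>T x - real n * (1 + e * (s\<^sup>2 - 1))\<bar> \<ge> a}"
    proof (rule P1.finite_measure_mono)
      have "\<bar>t - real n * (1 + e * (s\<^sup>2 - 1))\<bar> \<ge> a" if "\<bar>t - real n\<bar> < a" for t
      proof -
        have "t - real n * (1 + e * (s\<^sup>2 - 1)) = t - real n - m" by (simp add: m_def algebra_simps)
        then show ?thesis using that am by linarith
      qed
      then show "space P1 - chi_squared_region n a \<subseteq> {x \<in> space P1. \<bar>T x - real n * (1 + e * (s\<^sup>2 - 1))\<bar> \<ge> a}"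
        by (auto simp: chi_squared_region_def sp T_def not_le)
    qed measurable
    also have "\<dots> \<le> real n * (6 + 5 * e * (s\<^sup>2 - 1)\<^sup>2) / a\<^sup>2"
      using Cheb[of e s] es by (simp add: P1_def)
    finally show ?thesis .
  qed
  ultimately have "risk P0 P1 (chi_squared_region n a) \<le> real n * 6 / a\<^sup>2 + real n * (6 + 5 * e * (s\<^sup>2 - 1)\<^sup>2) / a\<^sup>2"
    unfolding risk_def by linarith
  also have "\<dots> = 48 / (real n * (e * (s\<^sup>2 - 1))\<^sup>2) + 20 / (real n * e)"
  proof -
    define u where "u = s\<^sup>2 - 1"
    have a2: "a\<^sup>2 = (real n * (e * u)) * (real n * (e * u)) / 4"
      by (simp add: a_def u_def power2_eq_square)
    have "u \<noteq> 0" using \<open>s\<^sup>2 - 1 \<noteq> 0\<close> u_def by simp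
    then show ?thesis using es n unfolding u_def[symmetric] a2
      by (simp add: power2_eq_square divide_simps)
  qed
  finally show ?thesis by (simp add: P0_def P1_def a_def mixture_0)
qed

section \<open>Weak convergence: continuous images and uniformity\<close>

text \<open>The continuous mapping theorem.\<close>

lemma weak_conv_m_distr_continuous:
  fixes g :: "real \<Rightarrow> real"
  assumes M: "\<And>n. real_distribution (M n)" and L: "real_distribution L"
    and "weak_conv_m M L" and g: "continuous_on UNIV g"
  shows "weak_conv_m (\<lambda>n. distr (M n) borel g) (distr L borel g)"
proof -
  have g_meas [measurable]: "g \<in> borel_measurable borel"
    using g by (rule borel_measurable_continuous_onI)
  have rv: "g \<in> borel_measurable N" if "real_distribution N" for N
    using that by (simp add: real_distribution.measurable_finite_borel)
  have rd: "real_distribution (distr N borel g)" if "real_distribution N" for N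
    using that rv[OF that] by (intro prob_space.real_distribution_distr) (auto simp: real_distribution_def)
  show ?thesis
  proof (rule integral_bdd_continuous_conv_imp_weak_conv)
    fix f :: "real \<Rightarrow> real" assume f: "\<And>x. isCont f x" "\<And>x. \<bar>f x\<bar> \<le> 1"
    have [measurable]: "f \<in> borel_measurable borel"
      using f(1) by (intro borel_measurable_continuous_onI continuous_at_imp_continuous_on) auto
    have "(\<lambda>n. \<integral>x. f (g x) \<partial>M n) \<longlonglongrightarrow> (\<integral>x. f (g x) \<partial>L)"
    proof (rule weak_conv_imp_integral_bdd_continuous_conv[OF M L \<open>weak_conv_m M L\<close>])
      show "isCont (\<lambda>x. f (g x)) x" for x
        using f(1) g by (auto intro!: isCont_o2[of _ g f] simp: continuous_on_eq_continuous_at)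
      show "norm (f (g x)) \<le> 1" for x using f(2) by simp
    qed
    then show "(\<lambda>n. \<integral>x. f x \<partial>distr (M n) borel g) \<longlonglongrightarrow> (\<integral>x. f x \<partial>distr L borel g)"
      by (simp add: integral_distr rv M L)
  qed (use M L rd in auto)
qed

text \<open>Polya's theorem. Between two consecutive points of a finite grid, both distribution functions
  are trapped by monotonicity, so pointwise convergence on the grid suffices. The grid points are
  quantiles of the limit, of levels \<open>k / N\<close>; they exist by the intermediate value
  theorem, since the limit has no atoms.\<close>

theorem weak_conv_m_imp_uniform_limit_cdf:
  assumes M: "\<And>n. real_distribution (M n)" and L: "real_distribution L"
    and conv: "weak_conv_m M L" and atomless: "\<And>x. measure L {x} = 0"
  shows "uniform_limit UNIV (\<lambda>n. cdf (M n)) (cdf L) sequentially"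
proof (rule uniform_limitI)
  fix \<epsilon> :: real assume "\<epsilon> > 0"
  interpret L: real_distribution L by fact
  interpret M: real_distribution "M n" for n by fact
  obtain N :: nat where N: "N > 0" "3 / real N < \<epsilon>"
    using reals_Archimedean2[of "3 / \<epsilon>"] \<open>\<epsilon> > 0\<close>
    by (metis divide_less_eq mult.commute not_gr_zero of_nat_0 of_nat_0_less_iff order_less_trans zero_less_divide_iff zero_less_numeral)
  have cont: "isCont (cdf L) x" for x using atomless by (simp add: L.isCont_cdf)
  have "\<exists>x. cdf L x = real k / real N" if "0 < k" "k < N" for k
  proof -
    have q: "0 < real k / real N" "real k / real N < 1" using that by auto
    obtain a where a: "cdf L a < real k / real N"
      using order_tendstoD(2)[OF L.cdf_lim_at_bot q(1)]
      by (metis eventually_happens' trivial_limit_at_bot_linorder)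
    obtain b where b: "cdf L b > real k / real N"
      using order_tendstoD(1)[OF L.cdf_lim_at_top_prob q(2)]
      by (metis eventually_happens' trivial_limit_at_top_linorder)
    have "a \<le> b" using a b L.cdf_nondecreasing[of b a] by linarith
    then show ?thesis using IVT[of "cdf L" a "real k / real N" b] a b cont by auto
  qed
  then obtain x where x: "\<And>k. 0 < k \<Longrightarrow> k < N \<Longrightarrow> cdf L (x k) = real k / real N" by metis
  have "\<forall>\<^sub>F n in sequentially. \<forall>k\<in>{0<..<N}. dist (cdf (M n) (x k)) (cdf L (x k)) < 1 / real N"
  proof (rule eventually_ball_finite)
    show "\<forall>k\<in>{0<..<N}. \<forall>\<^sub>F n in sequentially. dist (cdf (M n) (x k)) (cdf L (x k)) < 1 / real N"
      using conv cont N unfolding weak_conv_m_def weak_conv_def by (auto intro!: tendstoD)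
  qed simp
  then show "\<forall>\<^sub>F n in sequentially. \<forall>y\<in>UNIV. dist (cdf (M n) y) (cdf L y) < \<epsilon>"
  proof eventually_elim
    case (elim n)
    have grid: "\<bar>cdf (M n) (x k) - real k / real N\<bar> < 1 / real N" if "0 < k" "k < N" for k
      using elim that unfolding x[OF that, symmetric] by (simp add: dist_real_def)
    have "dist (cdf (M n) y) (cdf L y) \<le> 3 / real N" for y
    proof -
      \<comment> \<open>\<open>k\<close> is the level just below \<open>y\<close>. For the lower bound the grid point of level
          \<open>k - 1\<close> is used, since the one of level \<open>k\<close> may lie to the right of \<open>y\<close> where
          the limit is constant.\<close>
      define k where "k = nat \<lfloor>real N * cdf L y\<rfloor>"
      have "real k \<le> real N * cdf L y" "real N * cdf L y < real k + 1"
        using L.cdf_nonneg[of y] by (auto simp: k_def)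
      then have k: "real k / real N \<le> cdf L y" "cdf L y < (real k + 1) / real N"
        using N by (auto simp: field_simps)
      have "cdf (M n) y \<le> (real k + 2) / real N"
      proof (cases "k + 1 < N")
        case True
        then have "y \<le> x (k + 1)"
          using L.cdf_nondecreasing[of "x (k+1)" y] x[of "k+1"] k(2)
          by (cases "y \<le> x (k + 1)") (auto simp: add.commute)
        then have "cdf (M n) y \<le> cdf (M n) (x (k + 1))" by (rule M.cdf_nondecreasing)
        also have "\<dots> \<le> (real k + 2) / real N"
          using grid[of "k + 1"] True by (simp add: abs_less_iff add_divide_distrib)
        finally show ?thesis .
      next
        case False
        then have "1 \<le> (real k + 2) / real N" using N by (simp add: field_simps)
        then show ?thesis using M.cdf_bounded_prob[of n y] by linarith
      qed
      moreover have "(real k - 2) / real N \<le> cdf (M n) y"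
      proof (cases "k > 1")
        case True
        have "real k \<le> real N" using k(1) L.cdf_bounded_prob[of y] N
          by (meson divide_le_eq_1_pos of_nat_0_less_iff order_trans)
        then have kN: "k - 1 < N" using N True by linarith
        have r: "real (k - 1) = real k - 1" using True by simp
        have "x (k - 1) \<le> y"
        proof (rule ccontr)
          assume "\<not> x (k - 1) \<le> y"
          then have "cdf L y \<le> real (k - 1) / real N"
            using L.cdf_nondecreasing[of y "x (k-1)"] x[of "k-1"] True kN by auto
          moreover have "1 / real N > 0" using N by simp
          ultimately show False using k(1) unfolding r diff_divide_distrib by linarith
        qed
        then have "cdf (M n) (x (k - 1)) \<le> cdf (M n) y" by (rule M.cdf_nondecreasing)
        moreover have "(real k - 2) / real N \<le> cdf (M n) (x (k - 1))"
          using grid[of "k - 1"] True kN unfolding r by (auto simp: abs_less_iff diff_divide_distrib)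
        ultimately show ?thesis by linarith
      next
        case False
        then have "(real k - 2) / real N \<le> 0" using N by (simp add: field_simps)
        then show ?thesis using M.cdf_nonneg[of n y] by linarith
      qed
      ultimately show ?thesis using k by (auto simp: dist_real_def abs_le_iff add_divide_distrib diff_divide_distrib)
    qed
    then show ?case using N by (auto intro: le_less_trans)
  qed
qed

section \<open>Asymptotic normality under sparse contamination\<close>

text \<open>The index set \<open>I\<close> may be larger than the set of summands: the central limit theorem lives on
  one infinite product space, the samples of size \<open>n\<close> on finite ones, and this formula shows that
  their sums have the same characteristic function.\<close>

lemma char_distr_iid_sum:
  fixes f :: "'a \<Rightarrow> real" and c t :: real
  assumes "prob_space M" and f [measurable]: "f \<in> borel_measurable M" and J: "finite J" "J \<subseteq> I"
  shows "char (distr (Pi\<^sub>M I (\<lambda>_. M)) borel (\<lambda>\<omega>. (\<Sum>i\<in>J. f (\<omega> i)) / c)) t =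
    char (distr M borel f) (t / c) ^ card J"
proof -
  interpret M: prob_space M by fact
  let ?P = "Pi\<^sub>M I (\<lambda>_. M)"
  interpret P: prob_space ?P by (rule prob_space_PiM) (rule M.prob_space_axioms)
  have "P.indep_vars (\<lambda>_. borel) (\<lambda>i \<omega>. f (\<omega> i) / c) I"
    by (rule P.indep_vars_compose2[OF M.indep_vars_PiM_coordinates]) simp
  then have "P.indep_vars (\<lambda>_. borel) (\<lambda>i \<omega>. f (\<omega> i) / c) J"
    using J(2) by (rule P.indep_vars_subset)
  then have "char (distr ?P borel (\<lambda>\<omega>. \<Sum>i\<in>J. f (\<omega> i) / c)) t =
      (\<Prod>i\<in>J. char (distr ?P borel (\<lambda>\<omega>. f (\<omega> i) / c)) t)"
    by (rule P.char_distr_sum)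
  moreover have "char (distr ?P borel (\<lambda>\<omega>. f (\<omega> i) / c)) t = char (distr M borel f) (t / c)" if "i \<in> J" for i
  proof -
    have i: "i \<in> I" using that J(2) by auto
    have "distr ?P borel (\<lambda>\<omega>. f (\<omega> i) / c) = distr (distr ?P M (\<lambda>\<omega>. \<omega> i)) borel (\<lambda>x. f x / c)"
      using i by (subst distr_distr) (auto simp: comp_def)
    also have "\<dots> = distr M borel (\<lambda>x. f x / c)"
      using i by (simp add: M.distr_PiM_coordinate)
    finally show ?thesis by (simp add: char_def integral_distr)
  qed
  ultimately show ?thesis by (simp add: sum_divide_distrib)
qed

lemma norm_gaussian_char_minus_1_le:
  assumes "s > 0"
  shows "cmod ((\<integral>x. iexp (t * (x\<^sup>2 - 1)) \<partial>gaussian s) - 1) \<le> \<bar>t\<bar> * (s\<^sup>2 + 1)"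
proof -
  interpret G: prob_space "gaussian s" using assms by (rule prob_space_gaussian)
  have [measurable]: "(\<lambda>x. iexp (t * (x\<^sup>2 - 1))) \<in> borel_measurable (gaussian s)" by measurable
  have int: "integrable (gaussian s) (\<lambda>x. iexp (t * (x\<^sup>2 - 1)))"
    by (rule G.integrable_const_bound[where B=1]) auto
  have int2: "integrable (gaussian s) (\<lambda>x. x\<^sup>2 + 1)" using assms by simp
  have "(\<integral>x. iexp (t * (x\<^sup>2 - 1)) \<partial>gaussian s) - 1 = (\<integral>x. (iexp (t * (x\<^sup>2 - 1)) - 1) \<partial>gaussian s)"
    using int G.prob_space by simp
  also have "cmod \<dots> \<le> (\<integral>x. cmod (iexp (t * (x\<^sup>2 - 1)) - 1) \<partial>gaussian s)"
    by (rule integral_norm_bound)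
  also have "\<dots> \<le> (\<integral>x. \<bar>t\<bar> * (x\<^sup>2 + 1) \<partial>gaussian s)"
  proof (rule integral_mono)
    fix x :: real
    have "cmod (iexp (t * (x\<^sup>2 - 1)) - 1) \<le> \<bar>t * (x\<^sup>2 - 1)\<bar>"
      using iexp_approx1[of "t * (x\<^sup>2 - 1)" 0] by simp
    also have "\<dots> \<le> \<bar>t\<bar> * (x\<^sup>2 + 1)"
      unfolding abs_mult by (intro mult_left_mono) (auto simp: abs_le_iff)
    finally show "cmod (iexp (t * (x\<^sup>2 - 1)) - 1) \<le> \<bar>t\<bar> * (x\<^sup>2 + 1)" .
  qed (use int int2 in auto)
  also have "\<dots> = \<bar>t\<bar> * (s\<^sup>2 + 1)"
    using assms G.prob_space by (simp add: gaussian_moment_2)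
  finally show ?thesis .
qed

text \<open>The characteristic function of \<open>X\<^sup>2 - 1\<close>. The centring is that of the null law also
  under the alternative.\<close>

definition centred_square_char :: "real \<Rightarrow> real \<Rightarrow> real \<Rightarrow> complex" where
  "centred_square_char e s = char (distr (mixture e s) borel (\<lambda>x. x\<^sup>2 - 1))"

text \<open>Contamination enters the characteristic function linearly in \<open>e\<close>, and the factor
  \<open>t\<close> appears because both component laws have characteristic functions equal to 1 at 0.\<close>

lemma centred_square_char_mixture_diff:
  assumes "0 \<le> e" "e \<le> 1" "s > 0"
  shows "cmod (centred_square_char e s t - centred_square_char 0 1 t) \<le> e * \<bar>t\<bar> * (s\<^sup>2 + 3)"
proof -
  define \<psi> where "\<psi> r = (\<integral>x. iexp (t * (x\<^sup>2 - 1)) \<partial>gaussian r)" for r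
  have int: "integrable (gaussian r) (\<lambda>x. iexp (t * (x\<^sup>2 - 1)))" if "r > 0" for r
  proof -
    interpret G: prob_space "gaussian r" using that by (rule prob_space_gaussian)
    show ?thesis by (rule G.integrable_const_bound[where B=1]) auto
  qed
  have c: "centred_square_char e' s' t = (1 - e') *\<^sub>R \<psi> 1 + e' *\<^sub>R \<psi> s'" if "0 \<le> e'" "e' \<le> 1" "s' > 0" for e' s'
    unfolding centred_square_char_def \<psi>_def using integral_mixture[OF that int[of 1] int[of s']] that
    by (simp add: char_def integral_distr)
  have "centred_square_char e s t - centred_square_char 0 1 t = e *\<^sub>R ((\<psi> s - 1) - (\<psi> 1 - 1))"
    using assms by (simp add: c algebra_simps)
  also have "cmod \<dots> \<le> e * (cmod (\<psi> s - 1) + cmod (\<psi> 1 - 1))"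
    unfolding norm_scaleR using assms by (intro mult_mono norm_triangle_ineq4) auto
  also have "\<dots> \<le> e * (\<bar>t\<bar> * (s\<^sup>2 + 1) + \<bar>t\<bar> * (1\<^sup>2 + 1))"
    unfolding \<psi>_def using assms by (intro mult_left_mono add_mono norm_gaussian_char_minus_1_le) auto
  finally show ?thesis by (simp add: algebra_simps)
qed

text \<open>This is the central limit theorem for the sum of \<open>X\<^sub>i\<^sup>2 - 1\<close> under the null law,
  where the variance of \<open>X\<^sup>2\<close> is 2, read off in terms of characteristic functions.\<close>

lemma centred_square_char_null_tendsto:
  "(\<lambda>n. centred_square_char 0 1 (t / sqrt (real n * 2)) ^ n) \<longlonglongrightarrow> char std_normal_distribution t"
proof -
  interpret G: prob_space "gaussian 1" by (rule prob_space_gaussian) simp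
  let ?P = "Pi\<^sub>M (UNIV :: nat set) (\<lambda>_. gaussian 1)"
  interpret P: prob_space ?P by (rule prob_space_PiM) (rule G.prob_space_axioms)
  have c: "(\<lambda>\<omega>. \<omega> i) \<in> measurable ?P (gaussian 1)" and d: "distr ?P (gaussian 1) (\<lambda>\<omega>. \<omega> i) = gaussian 1" for i
    using G.distr_PiM_coordinate[of i UNIV] by simp_all
  have tr: "P.expectation (\<lambda>\<omega>. g (\<omega> i)) = G.expectation g"
    and tr': "integrable ?P (\<lambda>\<omega>. g (\<omega> i)) \<longleftrightarrow> integrable (gaussian 1) g"
    if "g \<in> borel_measurable borel" for i and g :: "real \<Rightarrow> real"
    using integral_distr[OF c, of g i] integrable_distr_eq[OF c, of g i] that
    by (simp_all add: d)
  have "weak_conv_m (\<lambda>n. distr ?P borel (\<lambda>\<omega>. (\<Sum>i<n. (\<omega> i)\<^sup>2 - 1) / sqrt (real n * (sqrt 2)\<^sup>2)))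
     std_normal_distribution"
  proof (rule P.central_limit_theorem)
    show "P.indep_vars (\<lambda>i. borel) (\<lambda>i \<omega>. (\<omega> i)\<^sup>2) UNIV"
      by (rule P.indep_vars_compose2[OF G.indep_vars_PiM_coordinates]) simp
    show m: "P.expectation (\<lambda>\<omega>. (\<omega> i)\<^sup>2) = 1" for i
      using tr[of "\<lambda>x. x\<^sup>2" i] by (simp add: gaussian_moment_2)
    show "integrable ?P (\<lambda>\<omega>. ((\<omega> i)\<^sup>2)\<^sup>2)" for i
      using tr'[of "\<lambda>x. (x\<^sup>2)\<^sup>2" i] by (simp flip: power_mult)
    show "P.variance (\<lambda>\<omega>. (\<omega> i)\<^sup>2) = (sqrt 2)\<^sup>2" for i
      using tr[of "\<lambda>x. (x\<^sup>2 - 1)\<^sup>2" i] mixture_variance_square[of 0 1]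
      by (simp add: m mixture_0 gaussian_moment_2)
    show "distr ?P borel (\<lambda>\<omega>. (\<omega> i)\<^sup>2) = distr (gaussian 1) borel (\<lambda>x. x\<^sup>2)" for i
      by (subst (2) d[of i, symmetric], subst distr_distr) (auto simp: comp_def)
  qed simp
  then have "(\<lambda>n. char (distr ?P borel (\<lambda>\<omega>. (\<Sum>i<n. (\<omega> i)\<^sup>2 - 1) / sqrt (real n * 2))) t)
      \<longlonglongrightarrow> char std_normal_distribution t"
    by (intro levy_continuity1 real_dist_normal_dist P.real_distribution_distr) simp_all
  moreover have "char (distr ?P borel (\<lambda>\<omega>. (\<Sum>i<n. (\<omega> i)\<^sup>2 - 1) / sqrt (real n * 2))) t =
      centred_square_char 0 1 (t / sqrt (real n * 2)) ^ n" for n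
    using char_distr_iid_sum[OF G.prob_space_axioms, where f = "\<lambda>x. x\<^sup>2 - 1" and J = "{..<n}" and I = UNIV]
    by (simp add: centred_square_char_def mixture_0)
  ultimately show ?thesis by simp
qed

definition chi_squared_statistic :: "nat \<Rightarrow> (nat \<Rightarrow> real) \<Rightarrow> real" where
  "chi_squared_statistic n x = ((\<Sum>i<n. (x i)\<^sup>2) - real n) / sqrt (real n * 2)"

lemma measurable_chi_squared_statistic [measurable]:
  "chi_squared_statistic n \<in> borel_measurable (iid_sample n (mixture e s))"
  unfolding chi_squared_statistic_def iid_sample_def by measurable

lemma prob_space_iid_sample_mixture:
  "0 \<le> e \<Longrightarrow> e \<le> 1 \<Longrightarrow> s > 0 \<Longrightarrow> prob_space (iid_sample n (mixture e s))"
  unfolding iid_sample_def by (intro prob_space_PiM prob_space_mixture)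

text \<open>At the argument \<open>t / sqrt (2 n)\<close>, one observation changes the characteristic function by
  \<open>O(e\<^sub>n / sqrt n)\<close>, hence \<open>n\<close> of them by \<open>O(sqrt n * e\<^sub>n)\<close>. So the contamination is invisible
  in the limit, which is the same as under the null law.\<close>

theorem chi_squared_statistic_weak_conv:
  assumes es: "\<And>n. 0 \<le> e n" "\<And>n. e n \<le> 1" "\<And>n. s n > 0" "\<And>n. s n \<le> B"
    and small: "(\<lambda>n. sqrt (real n) * e n) \<longlonglongrightarrow> 0"
  shows "weak_conv_m (\<lambda>n. distr (iid_sample n (mixture (e n) (s n))) borel (chi_squared_statistic n))
    std_normal_distribution"
proof (rule levy_continuity)
  show "real_distribution (distr (iid_sample n (mixture (e n) (s n))) borel (chi_squared_statistic n))" for n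
    using es by (intro prob_space.real_distribution_distr prob_space_iid_sample_mixture) simp_all
  show "real_distribution std_normal_distribution" by (rule real_dist_normal_dist)
  fix t :: real
  define u where "u n = t / sqrt (real n * 2)" for n
  define \<phi> where "\<phi> n = centred_square_char (e n) (s n) (u n)" for n
  define \<phi>0 where "\<phi>0 n = centred_square_char 0 1 (u n)" for n
  have \<phi>: "char (distr (iid_sample n (mixture (e n) (s n))) borel (chi_squared_statistic n)) t = \<phi> n ^ n" for n
    using char_distr_iid_sum[OF prob_space_mixture[OF es(1)[of n] es(2)[of n] es(3)[of n]],
        where f = "\<lambda>x. x\<^sup>2 - 1" and J = "{..<n}" and I = "{..<n}"]
    by (simp add: chi_squared_statistic_def[abs_def] iid_sample_def \<phi>_def u_def centred_square_char_def sum_subtractf)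
  have le_1: "cmod (centred_square_char e' s' v) \<le> 1" if "0 \<le> e'" "e' \<le> 1" "s' > 0" for e' s' v
    unfolding centred_square_char_def using prob_space_mixture[OF that]
    by (intro real_distribution.cmod_char_le_1 prob_space.real_distribution_distr) simp_all
  have "cmod (\<phi> n ^ n - \<phi>0 n ^ n) \<le> \<bar>t\<bar> * (B\<^sup>2 + 3) * (sqrt (real n) * e n)" for n
  proof -
    have "cmod (\<phi> n ^ n - \<phi>0 n ^ n) \<le> real n * cmod (\<phi> n - \<phi>0 n)"
      unfolding \<phi>_def \<phi>0_def using es by (intro norm_power_diff le_1) auto
    also have "\<dots> \<le> real n * (e n * \<bar>u n\<bar> * ((s n)\<^sup>2 + 3))"
      unfolding \<phi>_def \<phi>0_def using es by (intro mult_left_mono centred_square_char_mixture_diff) auto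
    also have "\<dots> \<le> real n * (e n * \<bar>u n\<bar> * (B\<^sup>2 + 3))"
      using es by (intro mult_left_mono add_mono power_mono mult_nonneg_nonneg) (auto intro: less_imp_le)
    also have "\<dots> = (real n * \<bar>u n\<bar>) * (B\<^sup>2 + 3) * e n" by simp
    also have "\<dots> \<le> (\<bar>t\<bar> * sqrt (real n)) * (B\<^sup>2 + 3) * e n"
    proof (intro mult_right_mono es)
      have "real n * \<bar>u n\<bar> = \<bar>t\<bar> * (real n / sqrt (real n)) / sqrt 2"
        by (simp add: u_def abs_divide real_sqrt_mult)
      also have "real n / sqrt (real n) = sqrt (real n)" by (rule real_div_sqrt) simp
      also have "\<bar>t\<bar> * sqrt (real n) / sqrt 2 \<le> \<bar>t\<bar> * sqrt (real n) / 1"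
        by (intro divide_left_mono) auto
      finally show "real n * \<bar>u n\<bar> \<le> \<bar>t\<bar> * sqrt (real n)" by simp
    qed simp
    finally show ?thesis by (simp add: ac_simps)
  qed
  moreover have "(\<lambda>n. \<bar>t\<bar> * (B\<^sup>2 + 3) * (sqrt (real n) * e n)) \<longlonglongrightarrow> 0"
    using tendsto_mult_left[OF small] by simp
  ultimately have "(\<lambda>n. \<phi> n ^ n - \<phi>0 n ^ n) \<longlonglongrightarrow> 0"
    by (intro Lim_null_comparison[of "\<lambda>n. \<phi> n ^ n - \<phi>0 n ^ n"] always_eventually) auto
  moreover have "(\<lambda>n. \<phi>0 n ^ n) \<longlonglongrightarrow> char std_normal_distribution t"
    unfolding \<phi>0_def u_def by (rule centred_square_char_null_tendsto)
  ultimately have "(\<lambda>n. (\<phi> n ^ n - \<phi>0 n ^ n) + \<phi>0 n ^ n) \<longlonglongrightarrow> 0 + char std_normal_distribution t"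
    by (rule tendsto_add)
  then show "(\<lambda>n. char (distr (iid_sample n (mixture (e n) (s n))) borel (chi_squared_statistic n)) t)
      \<longlonglongrightarrow> char std_normal_distribution t"
    by (simp add: \<phi>)
qed

section \<open>Powerlessness for sparse mixtures\<close>

lemma std_normal_singleton: "measure std_normal_distribution {x} = 0"
proof -
  have "absolutely_continuous lborel std_normal_distribution"
    by (intro absolutely_continuousI_density) simp
  then have "{x} \<in> null_sets std_normal_distribution"
    unfolding absolutely_continuous_def by (rule subsetD) (simp add: null_sets_def)
  then show ?thesis by (rule measure_eq_0_null_sets)
qed

text \<open>The event \<open>\<bar>S\<bar> \<ge> c\<close> is \<open>- \<bar>S\<bar> \<le> - c\<close>: passing from a statistic \<open>S\<close> to \<open>- \<bar>S\<bar>\<close> turns the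
  rejection probability, endpoint included, into the value of a distribution function.\<close>

lemma chi_squared_region_prob:
  assumes n: "n > 0"
  shows "measure (iid_sample n (mixture e s)) (chi_squared_region n c) =
    cdf (distr (distr (iid_sample n (mixture e s)) borel (chi_squared_statistic n)) borel (\<lambda>y. - \<bar>y\<bar>))
      (- c / sqrt (real n * 2))"
proof -
  let ?P = "iid_sample n (mixture e s)"
  have sp: "space ?P = space (Pi\<^sub>M {..<n} (\<lambda>_. borel))"
    by (simp add: iid_sample_def space_PiM)
  have "cdf (distr (distr ?P borel (chi_squared_statistic n)) borel (\<lambda>y. - \<bar>y\<bar>)) (- c / sqrt (real n * 2)) =
      measure ?P ((\<lambda>x. - \<bar>chi_squared_statistic n x\<bar>) -` {..- c / sqrt (real n * 2)} \<inter> space ?P)"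
    unfolding cdf_def by (subst distr_distr) (auto simp: measure_distr comp_def)
  also have "(\<lambda>x. - \<bar>chi_squared_statistic n x\<bar>) -` {..- c / sqrt (real n * 2)} \<inter> space ?P = chi_squared_region n c"
    using n by (auto simp: sp chi_squared_region_def chi_squared_statistic_def abs_divide divide_le_cancel)
  finally show ?thesis by simp
qed

text \<open>The critical values are arbitrary, so the rescaled ones need not converge. Uniform convergence
  of the distribution functions makes this harmless.\<close>

lemma chi_squared_region_prob_diff:
  assumes es: "\<And>n. 0 \<le> e n" "\<And>n. e n \<le> 1" "\<And>n. s n > 0" "\<And>n. s n \<le> B"
    and small: "(\<lambda>n. sqrt (real n) * e n) \<longlonglongrightarrow> 0"
  shows "(\<lambda>n. measure (iid_sample n (mixture (e n) (s n))) (chi_squared_region n (c n)) -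
    cdf (distr std_normal_distribution borel (\<lambda>y. - \<bar>y\<bar>)) (- c n / sqrt (real n * 2))) \<longlonglongrightarrow> 0"
proof -
  define S where "S n = distr (iid_sample n (mixture (e n) (s n))) borel (chi_squared_statistic n)" for n
  define L where "L = distr std_normal_distribution borel (\<lambda>y. - \<bar>y\<bar>)"
  interpret N: real_distribution std_normal_distribution by (rule real_dist_normal_dist)
  have S: "real_distribution (S n)" for n
    unfolding S_def using es by (intro prob_space.real_distribution_distr prob_space_iid_sample_mixture) simp_all
  then interpret S: real_distribution "S n" for n .
  have "weak_conv_m (\<lambda>n. distr (S n) borel (\<lambda>y. - \<bar>y\<bar>)) L"
    unfolding L_def
  proof (rule weak_conv_m_distr_continuous[OF S real_dist_normal_dist])
    show "weak_conv_m S std_normal_distribution"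
      unfolding S_def[abs_def] by (rule chi_squared_statistic_weak_conv[OF es small])
  qed (intro continuous_intros)
  moreover have "measure L {x} = 0" for x
  proof -
    have "measure L {x} = N.prob ((\<lambda>y. - \<bar>y\<bar>) -` {x})"
      unfolding L_def by (subst measure_distr) auto
    also have "\<dots> \<le> N.prob ({x} \<union> {-x})"
      by (rule N.finite_measure_mono) auto
    also have "\<dots> \<le> N.prob {x} + N.prob {-x}"
      by (rule measure_Un_le) auto
    finally show ?thesis by (simp add: std_normal_singleton measure_le_0_iff)
  qed
  ultimately have unif: "uniform_limit UNIV (\<lambda>n. cdf (distr (S n) borel (\<lambda>y. - \<bar>y\<bar>))) (cdf L) sequentially"
    unfolding L_def
    by (intro weak_conv_m_imp_uniform_limit_cdf S.real_distribution_distr N.real_distribution_distr) simp_all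
  have "(\<lambda>n. cdf (distr (S n) borel (\<lambda>y. - \<bar>y\<bar>)) (- c n / sqrt (real n * 2)) - cdf L (- c n / sqrt (real n * 2)))
      \<longlonglongrightarrow> 0"
  proof (rule tendstoI)
    fix \<epsilon> :: real assume "\<epsilon> > 0"
    from uniform_limitD[OF unif this]
    show "\<forall>\<^sub>F n in sequentially. dist (cdf (distr (S n) borel (\<lambda>y. - \<bar>y\<bar>)) (- c n / sqrt (real n * 2)) -
        cdf L (- c n / sqrt (real n * 2))) 0 < \<epsilon>"
      by eventually_elim (auto simp: dist_real_def)
  qed
  then show ?thesis
  proof (rule Lim_transform_eventually)
    show "\<forall>\<^sub>F n in sequentially. cdf (distr (S n) borel (\<lambda>y. - \<bar>y\<bar>)) (- c n / sqrt (real n * 2)) -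
        cdf L (- c n / sqrt (real n * 2)) =
      measure (iid_sample n (mixture (e n) (s n))) (chi_squared_region n (c n)) -
        cdf (distr std_normal_distribution borel (\<lambda>y. - \<bar>y\<bar>)) (- c n / sqrt (real n * 2))"
      using eventually_gt_at_top[of 0]
      by eventually_elim (simp add: chi_squared_region_prob S_def L_def)
  qed
qed

lemma eventually_admissible:
  assumes "\<beta> > 0"
  shows "eventually (admissible \<beta>) sequentially"
proof -
  have "(\<lambda>n. eps \<beta> n) \<longlonglongrightarrow> 0"
    unfolding eps_def using assms by real_asymp
  then have "\<forall>\<^sub>F n in sequentially. eps \<beta> n < 1 / 2"
    by (rule order_tendstoD) simp
  then show ?thesis
    using eventually_ge_at_top[of 1] by eventually_elim (simp add: admissible_def)
qed

text \<open>Under both hypotheses the rejection probability is asymptotically the same function of the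
  critical value, so they cancel and the risk even converges to 1.\<close>

lemma chi_squared_powerless_if_sparse:
  assumes \<beta>: "\<beta> > 1 / 2" and pos: "\<And>n. admissible \<beta> n \<Longrightarrow> \<sigma> n > 0"
    and bounded: "\<And>n. admissible \<beta> n \<Longrightarrow> \<sigma> n \<le> B"
  shows "chi_squared_powerless \<beta> \<sigma>"
  unfolding chi_squared_powerless_def asymptotically_powerless_def
proof
  fix c :: "nat \<Rightarrow> real"
  \<comment> \<open>The finitely many other sample sizes are given the null law, which makes the sequence of
      statistics meaningful for every \<open>n\<close> and does not change the limit.\<close>
  define e where "e n = (if admissible \<beta> n then eps \<beta> n else 0)" for n
  define s where "s n = (if admissible \<beta> n then \<sigma> n else 1)" for n
  define p0 where "p0 n = measure (iid_sample n (mixture 0 1)) (chi_squared_region n (c n))" for n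
  define p1 where "p1 n = measure (iid_sample n (mixture (e n) (s n))) (chi_squared_region n (c n))" for n
  have adm: "eventually (admissible \<beta>) sequentially"
    using \<beta> by (intro eventually_admissible) simp
  have es: "0 \<le> e n" "e n \<le> 1" "s n > 0" "s n \<le> max B 1" for n
    using pos[of n] bounded[of n] by (auto simp: e_def s_def admissible_def eps_def le_max_iff_disj)
  have "(\<lambda>n. sqrt (real n) * eps \<beta> n) \<longlonglongrightarrow> 0"
    unfolding eps_def using \<beta> by real_asymp
  then have "(\<lambda>n. sqrt (real n) * e n) \<longlonglongrightarrow> 0"
    by (rule Lim_transform_eventually) (use adm in eventually_elim, simp add: e_def)
  note lim1 = chi_squared_region_prob_diff[OF es this, where c = c]
  have lim0: "(\<lambda>n. p0 n - cdf (distr std_normal_distribution borel (\<lambda>y. - \<bar>y\<bar>)) (- c n / sqrt (real n * 2))) \<longlonglongrightarrow> 0"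
    unfolding p0_def by (rule chi_squared_region_prob_diff[where B=1]) simp_all
  have "(\<lambda>n. p0 n - p1 n) \<longlonglongrightarrow> 0"
    using tendsto_diff[OF lim0 lim1] by (simp add: p1_def)
  then have "(\<lambda>n. 1 + (p0 n - p1 n)) \<longlonglongrightarrow> 1 + 0"
    by (intro tendsto_intros)
  moreover have "\<forall>\<^sub>F n in sequentially. 1 + (p0 n - p1 n) = chi_squared_risk \<beta> \<sigma> c n"
    using adm
  proof eventually_elim
    case (elim n)
    interpret P1: prob_space "iid_sample n (mixture (e n) (s n))"
      using es by (intro prob_space_iid_sample_mixture)
    have "P1.prob (space (iid_sample n (mixture (e n) (s n))) - chi_squared_region n (c n)) = 1 - p1 n"
      unfolding p1_def by (intro P1.prob_compl chi_squared_region_sets) simp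
    then show ?case
      using elim by (simp add: chi_squared_risk_def risk_def p0_def e_def s_def mixture_0)
  qed
  ultimately have "chi_squared_risk \<beta> \<sigma> c \<longlonglongrightarrow> 1 + 0"
    by (rule Lim_transform_eventually)
  then have "(\<lambda>n. ereal (chi_squared_risk \<beta> \<sigma> c n)) \<longlonglongrightarrow> ereal 1"
    by simp
  from lim_imp_Liminf[OF sequentially_bot this]
  show "1 \<le> liminf (\<lambda>n. ereal (chi_squared_risk \<beta> \<sigma> c n))"
    by (simp add: one_ereal_def)
qed

section \<open>Power for dense mixtures\<close>

text \<open>The case of \<open>\<sigma>\<close> bounded away from 1 is \<open>\<gamma> = 0\<close>, that of
  \<open>\<bar>\<sigma> n - 1\<bar> = n powr (- \<gamma>)\<close> is \<open>\<delta> = 1\<close>.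
  Since \<open>\<bar>\<sigma>\<^sup>2 - 1\<bar> \<ge> \<bar>\<sigma> - 1\<bar>\<close>, the two terms of the Chebyshev bound are of order at most
  \<open>n powr (2 \<beta> + 2 \<gamma> - 1)\<close> and \<open>n powr (\<beta> - 1)\<close>.\<close>

lemma chi_squared_powerful_if_separated:
  assumes \<beta>: "0 < \<beta>" and "0 \<le> \<gamma>" "\<gamma> < 1 / 2 - \<beta>" and "\<delta> > 0"
    and pos: "\<And>n. admissible \<beta> n \<Longrightarrow> \<sigma> n > 0"
    and sep: "\<And>n. admissible \<beta> n \<Longrightarrow> \<bar>\<sigma> n - 1\<bar> \<ge> \<delta> * real n powr (- \<gamma>)"
  shows "chi_squared_powerful \<beta> \<sigma>"
proof -
  define c where "c n = real n * eps \<beta> n * \<bar>(\<sigma> n)\<^sup>2 - 1\<bar> / 2" for n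
  define b where "b n = 48 / (real n * (eps \<beta> n * (\<delta> * real n powr (- \<gamma>)))\<^sup>2) + 20 / (real n * eps \<beta> n)" for n
  have adm: "eventually (admissible \<beta>) sequentially"
    using \<beta> by (rule eventually_admissible)
  have "(\<lambda>n. 48 / \<delta>\<^sup>2 * real n powr (2 * \<beta> + 2 * \<gamma> - 1) + 20 * real n powr (\<beta> - 1)) \<longlonglongrightarrow> 0"
  proof -
    have "2 * \<beta> + 2 * \<gamma> - 1 < 0" "\<beta> - 1 < 0" using assms by simp_all
    then have "(\<lambda>n. real n powr (2 * \<beta> + 2 * \<gamma> - 1)) \<longlonglongrightarrow> 0" "(\<lambda>n. real n powr (\<beta> - 1)) \<longlonglongrightarrow> 0"
      by real_asymp+
    from tendsto_add[OF tendsto_mult_left[OF this(1), of "48 / \<delta>\<^sup>2"] tendsto_mult_left[OF this(2), of 20]]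
    show ?thesis by simp
  qed
  moreover have "\<forall>\<^sub>F n in sequentially.
      48 / \<delta>\<^sup>2 * real n powr (2 * \<beta> + 2 * \<gamma> - 1) + 20 * real n powr (\<beta> - 1) = b n"
    using eventually_gt_at_top[of 0]
  proof eventually_elim
    case (elim n)
    have "real n * (eps \<beta> n * (\<delta> * real n powr (- \<gamma>)))\<^sup>2 =
        \<delta>\<^sup>2 * (real n powr 1 * real n powr (- \<beta>) * real n powr (- \<beta>) * real n powr (- \<gamma>) * real n powr (- \<gamma>))"
      using elim by (simp add: eps_def power2_eq_square)
    also have "\<dots> = \<delta>\<^sup>2 * real n powr (- (2 * \<beta> + 2 * \<gamma> - 1))"
      unfolding powr_add[symmetric] by (simp add: algebra_simps)
    finally have 1: "real n * (eps \<beta> n * (\<delta> * real n powr (- \<gamma>)))\<^sup>2 =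
        \<delta>\<^sup>2 * real n powr (- (2 * \<beta> + 2 * \<gamma> - 1))" .
    have "real n * eps \<beta> n = real n powr 1 * real n powr (- \<beta>)"
      using elim by (simp add: eps_def)
    also have "\<dots> = real n powr (- (\<beta> - 1))"
      unfolding powr_add[symmetric] by simp
    finally have 2: "real n * eps \<beta> n = real n powr (- (\<beta> - 1))" .
    show ?case
      unfolding b_def 1 2 unfolding powr_minus by (simp only: divide_inverse inverse_mult_distrib inverse_inverse_eq)
  qed
  ultimately have b: "b \<longlonglongrightarrow> 0" by (rule Lim_transform_eventually)
  have "chi_squared_risk \<beta> \<sigma> c \<longlonglongrightarrow> 0"
  proof (rule tendsto_sandwich[OF _ _ tendsto_const b])
    show "\<forall>\<^sub>F n in sequentially. 0 \<le> chi_squared_risk \<beta> \<sigma> c n"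
      by (simp add: chi_squared_risk_def risk_def)
    show "\<forall>\<^sub>F n in sequentially. chi_squared_risk \<beta> \<sigma> c n \<le> b n"
      using adm
    proof eventually_elim
      case (elim n)
      have n: "n > 0" and e: "eps \<beta> n > 0" "eps \<beta> n \<le> 1"
        using elim by (auto simp: admissible_def eps_def)
      define d where "d = \<delta> * real n powr (- \<gamma>)"
      have d: "d > 0" using \<open>\<delta> > 0\<close> n by (simp add: d_def)
      have \<sigma>: "\<sigma> n > 0" "\<bar>\<sigma> n - 1\<bar> \<ge> d" using pos sep elim by (auto simp: d_def)
      have "d * 1 \<le> \<bar>\<sigma> n - 1\<bar> * \<bar>\<sigma> n + 1\<bar>" using \<sigma> d by (intro mult_mono) auto
      also have "\<dots> = \<bar>(\<sigma> n)\<^sup>2 - 1\<bar>" by (simp add: power2_eq_square algebra_simps flip: abs_mult)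
      finally have "d \<le> \<bar>(\<sigma> n)\<^sup>2 - 1\<bar>" by simp
      then have "d\<^sup>2 \<le> ((\<sigma> n)\<^sup>2 - 1)\<^sup>2" using d by (simp add: power2_le_iff_abs_le abs_le_square_iff[symmetric])
      then have "real n * (eps \<beta> n * d)\<^sup>2 \<le> real n * (eps \<beta> n * ((\<sigma> n)\<^sup>2 - 1))\<^sup>2"
        unfolding power_mult_distrib by (intro mult_left_mono) auto
      moreover have "0 < real n * (eps \<beta> n * d)\<^sup>2" using n e d by simp
      ultimately have "48 / (real n * (eps \<beta> n * ((\<sigma> n)\<^sup>2 - 1))\<^sup>2) \<le> 48 / (real n * (eps \<beta> n * d)\<^sup>2)"
        by (simp add: frac_le)
      moreover have "\<sigma> n \<noteq> 1" using \<sigma> d by auto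
      ultimately show ?case
        using chi_squared_risk_le[OF e \<sigma>(1) _ n] unfolding chi_squared_risk_def c_def b_def d_def[symmetric]
        by linarith
    qed
  qed
  then show ?thesis unfolding chi_squared_powerful_def asymptotically_powerful_def by blast
qed

section \<open>The two regimes of the chi-squared test\<close>

theorem proposition1:
  fixes \<beta> :: real and \<sigma> :: "nat \<Rightarrow> real"
  assumes "0 < \<beta>" and "\<beta> < 1"
    and "\<And>n. admissible \<beta> n \<Longrightarrow> \<sigma> n > 0"
  shows "(\<beta> < 1 / 2 \<and>
          ((\<exists>\<delta>>0. \<forall>n. admissible \<beta> n \<longrightarrow> \<bar>\<sigma> n - 1\<bar> \<ge> \<delta>) \<or>
           (\<exists>\<gamma>>0. \<gamma> < 1 / 2 - \<beta> \<and>
              (\<forall>n. admissible \<beta> n \<longrightarrow> \<bar>\<sigma> n - 1\<bar> = real n powr (- \<gamma>))))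
          \<longrightarrow> chi_squared_powerful \<beta> \<sigma>) \<and>
         (\<beta> > 1 / 2 \<and> (\<exists>B. \<forall>n. admissible \<beta> n \<longrightarrow> \<sigma> n \<le> B)
          \<longrightarrow> chi_squared_powerless \<beta> \<sigma>)"
proof (intro conjI impI; elim conjE disjE exE)
  fix \<delta> assume "\<beta> < 1 / 2" "\<delta> > 0" and sep: "\<forall>n. admissible \<beta> n \<longrightarrow> \<bar>\<sigma> n - 1\<bar> \<ge> \<delta>"
  moreover have "\<bar>\<sigma> n - 1\<bar> \<ge> \<delta> * real n powr (- 0)" if "admissible \<beta> n" for n
    using that sep by (auto simp: admissible_def)
  ultimately show "chi_squared_powerful \<beta> \<sigma>"
    using assms by (intro chi_squared_powerful_if_separated[where \<gamma> = 0 and \<delta> = \<delta>]) auto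
next
  fix \<gamma> assume "\<gamma> > 0" "\<gamma> < 1 / 2 - \<beta>"
    and "\<forall>n. admissible \<beta> n \<longrightarrow> \<bar>\<sigma> n - 1\<bar> = real n powr (- \<gamma>)"
  then show "chi_squared_powerful \<beta> \<sigma>"
    using assms by (intro chi_squared_powerful_if_separated[where \<gamma> = \<gamma> and \<delta> = 1]) auto
next
  fix B assume "\<beta> > 1 / 2" "\<forall>n. admissible \<beta> n \<longrightarrow> \<sigma> n \<le> B"
  then show "chi_squared_powerless \<beta> \<sigma>"
    using assms(3) by (intro chi_squared_powerless_if_sparse[where B = B]) auto
qed

end
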